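(* Let $n\ge 1$ be an integer, let $f\in L^2(\mathbb{R}^n)$ be complex-valued, and let $$F(\lambda)=\int_{\mathbb{R}^n}\overline{f(x)}\,f(\lambda x)\,d\mathrm{vol}_n(x),\qquad \lambda\in\mathbb{R}^\times.$$ Suppose that $F$ has a holomorphic extension (also denoted $F$) to a neighborhood of $\bar{\mathbb{D}}\setminus\{i,-i\}$ such that $$\int_{\mathbb{D}}|F(\lambda)|^2\,|\lambda^2+1|^n\,dA(\lambda)<+\infty.$$ Then: (a) there is a constant $c_0\ge 0$ such that $F(\lambda)=c_0(1+\lambda^2)^{-n/2}$ for all $\lambda\in\mathbb{R}^\times$; and (b) if, in addition, $c_0=0$, then $F\equiv 0$ and consequently $f=0$ almost everywhere on $\mathbb{R}^n$.
   Context: $\mathbb{R}^\times=\mathbb{R}\setminus\{0\}$, and $d\mathrm{vol}_n$ is volume (Lebesgue) measure on $\mathbb{R}^n$. $\mathbb{D}=\{z\in\mathbb{C}:|z|<1\}$ is the open unit disk, $\bar{\mathbb{D}}$ is its closure, and $dA$ is the area element in $\mathbb{C}$. That $F$ has a holomorphic extension to a neighborhood of $\bar{\mathbb{D}}\setminus\{i,-i\}$ means that there are an open set $U\subset\mathbb{C}$ containing $\bar{\mathbb{D}}\setminus\{i,-i\}$ and a holomorphic function on $U$ which coincides with $F$ on $U\cap\mathbb{R}^\times$. *)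

theory Defs
  imports "HOL-Analysis.Analysis"
begin

(* L^2 membership for a representative function. Measurability refers to the completed
   (Lebesgue) sigma-algebra, which, unlike the Borel sets, is closed under modification
   on null sets. *)
definition L2_fun :: "('a::euclidean_space \<Rightarrow> complex) \<Rightarrow> bool" where
  "L2_fun f \<longleftrightarrow>
     f \<in> borel_measurable lebesgue \<and> integrable lebesgue (\<lambda>x. (cmod (f x))\<^sup>2)"

(* For f in L^2 and t \<noteq> 0 the integrand is integrable, so the Bochner integral does not
   fall back to its default value 0. Only t \<noteq> 0 is meaningful. *)
definition dilation_corr :: "('a::euclidean_space \<Rightarrow> complex) \<Rightarrow> real \<Rightarrow> complex" where
  "dilation_corr f t = (\<integral>x. cnj (f x) * f (t *\<^sub>R x) \<partial>lebesgue)"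

(* G is a holomorphic extension of a function F on the nonzero reals to the open
   neighbourhood U of the closed unit disk punctured at i and -i. *)
definition holomorphic_extension_on ::
  "complex set \<Rightarrow> (complex \<Rightarrow> complex) \<Rightarrow> (real \<Rightarrow> complex) \<Rightarrow> bool" where
  "holomorphic_extension_on U G F \<longleftrightarrow>
     open U \<and> cball 0 1 - {\<i>, -\<i>} \<subseteq> U \<and> G holomorphic_on U \<and>
     (\<forall>t. t \<noteq> 0 \<and> complex_of_real t \<in> U \<longrightarrow> G (complex_of_real t) = F t)"

end

theory Submission
  imports Defs "HOL-Complex_Analysis.Complex_Analysis"
begin

text \<open>
  Substituting \<open>x \<mapsto> t x\<close> gives \<open>F(1/t) = |t|^n cnj(F(t))\<close> for real \<open>t \<noteq> 0\<close>. Hence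
  \<open>h(z) = G(z) (1 + z^2)^(n/2)\<close> satisfies \<open>h(1/t) = cnj(h(t))\<close> for real \<open>t\<close> near \<open>1\<close> and near \<open>-1\<close>,
  so by the identity theorem \<open>z \<mapsto> cnj(h(1/cnj(z)))\<close> continues \<open>h\<close> across both open half circles
  to a holomorphic function on \<open>\<complex> - {\<i>, -\<i>}\<close> that is bounded at infinity. The weighted area integral
  is the square integral of \<open>h\<close> over the disc, and circle inversion transports it to the exterior.
  By the area mean value property, a holomorphic function that is square integrable near an isolated
  singularity extends over it, so the continuation is entire and Liouville's theorem makes \<open>h\<close>
  constant. The constant is \<open>h(1) = 2^(n/2) F(1)\<close>, where \<open>F(1)\<close> is the square of the \<open>L^2\<close> norm of \<open>f\<close>.
\<close>

section \<open>Change of variables in the complex plane\<close>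

text \<open>Change of variables is applied in \<open>real^2\<close>, where the Jacobian is the
  determinant of a matrix. This map and its inverse carry sets, functions and integrals there and
  back.\<close>

definition vec_of_complex :: "complex \<Rightarrow> real^2" where
  "vec_of_complex z = (\<chi> i. if i = 1 then Re z else Im z)"

definition complex_of_vec :: "real^2 \<Rightarrow> complex" where
  "complex_of_vec v = Complex (v $ 1) (v $ 2)"

lemma complex_of_vec_inverse [simp]:
  "complex_of_vec (vec_of_complex z) = z" "vec_of_complex (complex_of_vec v) = v"
  by (simp_all add: complex_of_vec_def vec_of_complex_def vec_eq_iff forall_2)

lemma bounded_linear_vec_of_complex: "bounded_linear vec_of_complex"
  by (intro bounded_linearI' ) (auto simp: vec_of_complex_def vec_eq_iff)

lemma bounded_linear_complex_of_vec: "bounded_linear complex_of_vec"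
  by (intro linear_conv_bounded_linear[THEN iffD1] linearI) (auto simp: complex_of_vec_def complex_eq_iff)

text \<open>A Borel measure that gives every box its volume is Lebesgue measure, and boxes pull back
  to boxes with the same side lengths.\<close>

lemma lborel_complex_of_vec: "lborel = distr lborel borel complex_of_vec"
proof (rule lborel_eqI)
  fix l u :: complex
  assume lu: "\<And>b. b \<in> Basis \<Longrightarrow> l \<bullet> b \<le> u \<bullet> b"
  have m: "complex_of_vec \<in> borel_measurable borel"
    by (intro borel_measurable_continuous_onI linear_continuous_on bounded_linear_complex_of_vec)
  have "complex_of_vec -` box l u = box (vec_of_complex l) (vec_of_complex u)"
    by (rule set_eqI)
      (auto simp: mem_box_cart forall_2 in_box_complex_iff complex_of_vec_def vec_of_complex_def)
  moreover have "(\<Prod>b\<in>Basis. (vec_of_complex u - vec_of_complex l) \<bullet> b) = (\<Prod>b\<in>Basis. (u - l) \<bullet> b)"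
    by (simp add: Basis_vec_def vec_of_complex_def Basis_complex_def UNION_singleton_eq_range
       prod.reindex axis_eq_axis inj_on_def UNIV_2 inner_axis)
  moreover have "\<And>b. b \<in> Basis \<Longrightarrow> vec_of_complex l \<bullet> b \<le> vec_of_complex u \<bullet> b"
    using lu[of 1] lu[of \<i>]
    by (auto simp: Basis_vec_def vec_of_complex_def Basis_complex_def inner_axis)
  ultimately show "emeasure (distr lborel borel complex_of_vec) (box l u) = (\<Prod>b\<in>Basis. (u - l) \<bullet> b)"
    using m by (simp add: emeasure_distr emeasure_lborel_box)
qed simp

text \<open>A measure-preserving Borel map pulls null sets back to null sets, so it stays measurable
  and measure-preserving after completion.\<close>

lemma lebesgue_distr_of_lborel:
  fixes T :: "'a::euclidean_space \<Rightarrow> 'b::euclidean_space"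
  assumes T: "T \<in> borel_measurable borel" and d: "distr lborel borel T = lborel"
  shows "distr lebesgue lebesgue T = lebesgue" and "T \<in> lebesgue \<rightarrow>\<^sub>M lebesgue"
proof -
  have m: "T \<in> lborel \<rightarrow>\<^sub>M lborel" using T by simp
  have d': "distr lebesgue lborel T = lborel"
    using distr_completion[OF m] d by (simp cong: distr_cong)
  show "distr lebesgue lebesgue T = lebesgue"
    using completion.completion_distr_eq[OF measurable_completion[OF m]] d' by simp
  show "T \<in> lebesgue \<rightarrow>\<^sub>M lebesgue"
    using measurable_completion[OF m]
    by (rule completion.measurable_completion2) (use d' in simp)
qed

lemma borel_measurable_complex_of_vec: "complex_of_vec \<in> borel_measurable borel"
  by (intro borel_measurable_continuous_onI linear_continuous_on bounded_linear_complex_of_vec)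

lemma borel_measurable_vec_of_complex: "vec_of_complex \<in> borel_measurable borel"
  by (intro borel_measurable_continuous_onI linear_continuous_on bounded_linear_vec_of_complex)

lemma lborel_vec_of_complex: "distr lborel borel vec_of_complex = lborel"
  by (subst lborel_complex_of_vec, subst distr_distr)
    (simp_all add: borel_measurable_complex_of_vec borel_measurable_vec_of_complex o_def distr_id2)

lemmas lebesgue_complex_of_vec =
  lebesgue_distr_of_lborel[OF borel_measurable_complex_of_vec lborel_complex_of_vec[symmetric]]
lemmas lebesgue_vec_of_complex =
  lebesgue_distr_of_lborel[OF borel_measurable_vec_of_complex lborel_vec_of_complex]

text \<open>Values are transported along with arguments because the change of variables theorem
  takes vector-valued integrands. Once the indicator is absorbed into \<open>k\<close>, both claims
  are invariance under push-forward.\<close>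

lemma set_integrable_complex_of_vec_iff:
  fixes f :: "complex \<Rightarrow> complex"
  shows "set_integrable lebesgue (complex_of_vec -` S) (\<lambda>v. vec_of_complex (f (complex_of_vec v)))
           \<longleftrightarrow> set_integrable lebesgue S f" (is "?L \<longleftrightarrow> ?R")
    and "set_integrable lebesgue S f \<Longrightarrow>
           (LINT v:complex_of_vec -` S|lebesgue. vec_of_complex (f (complex_of_vec v)))
           = vec_of_complex (LINT z:S|lebesgue. f z)"
proof -
  define k where "k = (\<lambda>z. indicator S z *\<^sub>R f z)"
  have eq: "indicator (complex_of_vec -` S) v *\<^sub>R vec_of_complex (f (complex_of_vec v)) = vec_of_complex (k (complex_of_vec v))" for v
    by (simp add: k_def linear_simps[OF bounded_linear_vec_of_complex] indicator_def)
  show "?L \<longleftrightarrow> ?R"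
  proof
    assume ?L
    then have "integrable lebesgue (\<lambda>v. vec_of_complex (k (complex_of_vec v)))"
      unfolding set_integrable_def eq .
    then have "integrable lebesgue (\<lambda>v. complex_of_vec (vec_of_complex (k (complex_of_vec v))))"
      by (rule integrable_bounded_linear[OF bounded_linear_complex_of_vec])
    then have "integrable (distr lebesgue lebesgue vec_of_complex) (\<lambda>v. k (complex_of_vec v))"
      by (simp add: lebesgue_vec_of_complex(1))
    from integrable_distr[OF lebesgue_vec_of_complex(2) this]
    show ?R by (simp add: set_integrable_def k_def)
  next
    assume ?R
    then have "integrable (distr lebesgue lebesgue complex_of_vec) k"
      by (simp add: set_integrable_def k_def lebesgue_complex_of_vec(1))
    from integrable_bounded_linear[OF bounded_linear_vec_of_complex integrable_distr[OF lebesgue_complex_of_vec(2) this]]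
    show ?L unfolding set_integrable_def eq .
  qed
  assume ?R
  then have k: "integrable lebesgue k" by (simp add: set_integrable_def k_def)
  then have k': "integrable (distr lebesgue lebesgue complex_of_vec) k"
    by (simp add: lebesgue_complex_of_vec(1))
  have "(LINT v|lebesgue. vec_of_complex (k (complex_of_vec v))) = vec_of_complex (LINT v|lebesgue. k (complex_of_vec v))"
    by (rule integral_bounded_linear[OF bounded_linear_vec_of_complex integrable_distr[OF lebesgue_complex_of_vec(2) k']])
  also have "(LINT v|lebesgue. k (complex_of_vec v)) = (LINT z|distr lebesgue lebesgue complex_of_vec. k z)"
    using borel_measurable_integrable[OF k] by (subst integral_distr[OF lebesgue_complex_of_vec(2)]) auto
  finally show "(LINT v:complex_of_vec -` S|lebesgue. vec_of_complex (f (complex_of_vec v)))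
           = vec_of_complex (LINT z:S|lebesgue. f z)"
    unfolding set_lebesgue_integral_def eq by (simp add: k_def lebesgue_complex_of_vec(1))
qed

text \<open>Here \<open>a\<close> and \<open>b\<close> are the Wirtinger derivatives of \<open>g\<close>, with Jacobian \<open>|a|^2 - |b|^2\<close>.\<close>

lemma complex_change_of_variables:
  fixes f g :: "complex \<Rightarrow> complex" and a b :: "complex \<Rightarrow> complex"
  assumes S: "S \<in> sets lebesgue"
    and der: "\<And>z. z \<in> S \<Longrightarrow> (g has_derivative (\<lambda>h. a z * h + b z * cnj h)) (at z within S)"
    and inj: "inj_on g S"
    and int: "set_integrable lebesgue (g ` S) f"
  shows "set_integrable lebesgue S (\<lambda>z. \<bar>(cmod (a z))\<^sup>2 - (cmod (b z))\<^sup>2\<bar> *\<^sub>R f (g z))"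
    and "(LINT z:S|lebesgue. \<bar>(cmod (a z))\<^sup>2 - (cmod (b z))\<^sup>2\<bar> *\<^sub>R f (g z)) = (LINT z:g ` S|lebesgue. f z)"
proof -
  define T where "T = vec_of_complex ` S"
  define G where "G = vec_of_complex \<circ> g \<circ> complex_of_vec"
  define F where "F = vec_of_complex \<circ> f \<circ> complex_of_vec"
  define G' where "G' v = (\<lambda>h. vec_of_complex (a (complex_of_vec v) * complex_of_vec h + b (complex_of_vec v) * cnj (complex_of_vec h)))" for v
  have T_eq: "T = complex_of_vec -` S"
    unfolding T_def by (force simp: image_iff intro: bexI[of _ "complex_of_vec _"])
  have GT: "G ` T = complex_of_vec -` (g ` S)"
    unfolding T_eq G_def by (auto simp: image_iff o_def)
      (metis vimageI complex_of_vec_inverse)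
  have T: "T \<in> sets lebesgue"
    using measurable_sets[OF lebesgue_complex_of_vec(2) S] by (simp add: T_eq)
  have derG: "(G has_derivative G' v) (at v within T)" if "v \<in> T" for v
  proof -
    have 1: "(complex_of_vec has_derivative complex_of_vec) (at v within T)"
      by (rule bounded_linear.has_derivative[OF bounded_linear_complex_of_vec has_derivative_ident])
    have "complex_of_vec v \<in> S" using that by (simp add: T_eq)
    have 2: "(g has_derivative (\<lambda>h. a (complex_of_vec v) * h + b (complex_of_vec v) * cnj h))
       (at (complex_of_vec v) within complex_of_vec ` T)"
      using der[of "complex_of_vec v"] that unfolding T_def by (auto simp: image_image)
    show ?thesis
      using bounded_linear.has_derivative[OF bounded_linear_vec_of_complex has_derivative_in_compose[OF 1 2]]
      unfolding G_def G'_def o_def by simp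
  qed
  have injG: "inj_on G T"
    using inj unfolding inj_on_def G_def T_def by (auto, metis complex_of_vec_inverse(1))
  have det: "det (matrix (G' v)) = (cmod (a (complex_of_vec v)))\<^sup>2 - (cmod (b (complex_of_vec v)))\<^sup>2" for v
    unfolding det_2 matrix_def G'_def cmod_power2
    by (simp add: complex_of_vec_def vec_of_complex_def axis_def power2_eq_square algebra_simps)
  have F_int: "set_integrable lebesgue (G ` T) F"
    using int unfolding GT F_def o_def by (simp add: set_integrable_complex_of_vec_iff(1))
  define D where "D = (\<lambda>z. \<bar>(cmod (a z))\<^sup>2 - (cmod (b z))\<^sup>2\<bar> *\<^sub>R f (g z))"
  have "(\<lambda>x. \<bar>det (matrix (G' x))\<bar> *\<^sub>R F (G x)) = (\<lambda>v. vec_of_complex (D (complex_of_vec v)))"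
    unfolding det F_def G_def D_def o_def by (simp add: linear_simps[OF bounded_linear_vec_of_complex])
  \<comment> \<open>The theorem is an equivalence about a prescribed value of the gauge integral.
    Prescribing the value over the image yields integrability and equality at once.\<close>
  with has_absolute_integral_change_of_variables[OF T derG injG, of F "integral (G ` T) F"] F_int
  have D: "set_integrable lebesgue T (\<lambda>v. vec_of_complex (D (complex_of_vec v)))"
     and eq: "integral T (\<lambda>v. vec_of_complex (D (complex_of_vec v))) = integral (G ` T) F"
    by auto
  show D': "set_integrable lebesgue S (\<lambda>z. \<bar>(cmod (a z))\<^sup>2 - (cmod (b z))\<^sup>2\<bar> *\<^sub>R f (g z))"
    using D set_integrable_complex_of_vec_iff(1)[of S D] unfolding T_eq D_def by blast
  have "vec_of_complex (LINT z:S|lebesgue. D z) = (LINT v:T|lebesgue. vec_of_complex (D (complex_of_vec v)))"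
    using set_integrable_complex_of_vec_iff(2)[OF D'] unfolding T_eq D_def by simp
  also have "\<dots> = (LINT v:G ` T|lebesgue. F v)"
    using eq D F_int by (simp add: set_lebesgue_integral_eq_integral)
  also have "\<dots> = vec_of_complex (LINT z:g ` S|lebesgue. f z)"
    using int by (simp add: GT F_def o_def set_integrable_complex_of_vec_iff(2))
  finally show "(LINT z:S|lebesgue. \<bar>(cmod (a z))\<^sup>2 - (cmod (b z))\<^sup>2\<bar> *\<^sub>R f (g z)) = (LINT z:g ` S|lebesgue. f z)"
    unfolding D_def by (metis complex_of_vec_inverse(1))
qed

section \<open>Square integrable holomorphic functions\<close>

lemma set_integrable_ball_continuous:
  fixes f :: "complex \<Rightarrow> 'b::euclidean_space"
  assumes "continuous_on (cball a r) f"
  shows "set_integrable lebesgue (ball a r) f"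
proof -
  have "set_integrable lebesgue (cball a r) f"
    using borel_integrable_compact[OF compact_cball assms] borel_measurable_integrable
    by (auto simp: set_integrable_def integrable_completion)
  then show ?thesis
    by (rule set_integrable_subset) auto
qed

text \<open>Rotating by a \<open>k\<close>-th root of \<open>-1\<close> preserves the ball and changes the sign of \<open>z ^ k\<close>.\<close>

lemma integral_ball_power_eq_0:
  assumes "k > 0"
  shows "(LINT z:ball 0 r|lebesgue. z ^ k :: complex) = 0"
proof -
  define \<zeta> where "\<zeta> = cis (pi / k)"
  have \<zeta>: "cmod \<zeta> = 1" "\<zeta> ^ k = -1"
    using assms by (simp_all add: \<zeta>_def Complex.DeMoivre)
  then have "\<zeta> \<noteq> 0" by auto
  have im: "(*) \<zeta> ` ball 0 r = ball 0 r"
  proof -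
    have "w \<in> (*) \<zeta> ` ball 0 r" if "w \<in> ball 0 r" for w
      using that \<zeta> \<open>\<zeta> \<noteq> 0\<close> by (intro image_eqI[of _ _ "w / \<zeta>"]) (auto simp: norm_divide)
    then show ?thesis using \<zeta> by (auto simp: norm_mult)
  qed
  \<comment> \<open>The rotation has Wirtinger derivatives \<open>\<zeta>\<close> and 0, hence
    Jacobian 1.\<close>
  have "(LINT z:ball 0 r|lebesgue. \<bar>(cmod \<zeta>)\<^sup>2 - (cmod 0)\<^sup>2\<bar> *\<^sub>R (\<zeta> * z) ^ k) = (LINT z:(*) \<zeta> ` ball 0 r|lebesgue. z ^ k)"
    by (rule complex_change_of_variables(2))
      (use \<open>\<zeta> \<noteq> 0\<close> in \<open>auto intro!: inj_onI derivative_eq_intros set_integrable_ball_continuous continuous_intros simp: im\<close>)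
  then have "(LINT z:ball 0 r|lebesgue. z ^ k :: complex) = - (LINT z:ball 0 r|lebesgue. z ^ k)"
    using \<zeta> by (simp add: im power_mult_distrib set_lebesgue_integral_def)
  then show ?thesis by simp
qed

text \<open>Area mean value property at the centre: the Taylor series is integrated term by term,
  and only the constant term contributes.\<close>

lemma holomorphic_integral_ball_0:
  assumes f: "f holomorphic_on ball 0 R" and r: "0 < r" "r < R"
  shows "(LINT z:ball 0 r|lebesgue. f z) = f 0 * of_real (measure lebesgue (ball (0::complex) r))"
proof -
  define c where "c n = (deriv ^^ n) f 0 / fact n" for n
  have sums: "(\<lambda>n. c n * z ^ n) sums f z" if "z \<in> ball 0 R" for z
    using holomorphic_power_series[OF f that] by (simp add: c_def)
  have half: "cmod (of_real r + of_real R) = r + R"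
    using r by (simp flip: of_real_add)
  have summ: "summable (\<lambda>n. norm (c n) * r ^ n)"
  proof -
    \<comment> \<open>Convergence at \<open>(r + R) / 2\<close>, strictly between \<open>r\<close>
      and \<open>R\<close>, gives absolute convergence at radius \<open>r\<close>, which dominates
      the series on the smaller ball.\<close>
    have "summable (\<lambda>n. c n * (of_real ((r + R) / 2)) ^ n)"
      using r half by (intro sums_summable[OF sums]) simp
    then have "summable (\<lambda>n. norm (c n * (of_real r) ^ n))"
      by (rule powser_insidea) (use r half in auto)
    then show ?thesis using r by (simp add: norm_mult norm_power)
  qed
  define u where "u n z = indicator (ball 0 r) z *\<^sub>R (c n * z ^ n)" for n and z :: complex
  have u_int: "integrable lebesgue (u n)" for n
  proof -
    have "continuous_on (cball 0 r) (\<lambda>z. c n * z ^ n)"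
      by (intro continuous_intros)
    from set_integrable_ball_continuous[OF this] show ?thesis
      unfolding u_def[abs_def] set_integrable_def .
  qed
  have u_sums: "(\<lambda>n. u n z) sums (indicator (ball 0 r) z *\<^sub>R f z)" for z
    unfolding u_def by (cases "z \<in> ball 0 r") (use sums[of z] r in auto)
  have u_norm: "norm (u n z) \<le> (norm (c n) * r ^ n) * indicator (ball 0 r) z" for n z
    unfolding u_def by (cases "z \<in> ball 0 r")
     (auto simp: norm_mult norm_power intro!: mult_left_mono power_mono)
  \<comment> \<open>Summability of the integrals of the norms permits exchanging sum and
    integral.\<close>
  have "summable (\<lambda>n. \<integral>z. norm (u n z) \<partial>lebesgue)"
  proof (rule summable_comparison_test[OF exI[of _ 0]])
    show "\<forall>n\<ge>0. norm (\<integral>z. norm (u n z) \<partial>lebesgue) \<le> (norm (c n) * r ^ n) * measure lebesgue (ball (0::complex) r)"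
    proof (intro allI impI)
      fix n
      have "(\<integral>z. norm (u n z) \<partial>lebesgue) \<le> (\<integral>z. (norm (c n) * r ^ n) * indicator (ball (0::complex) r) z \<partial>lebesgue)"
      proof (rule integral_mono)
        show "integrable lebesgue (\<lambda>z. norm (u n z))" using u_int by (rule integrable_norm)
        show "integrable lebesgue (\<lambda>z::complex. (norm (c n) * r ^ n) * indicator (ball 0 r) z)"
          by (intro integrable_mult_right integrable_real_indicator) (simp_all add: emeasure_bounded_finite[unfolded infinity_ennreal_def])
      qed (rule u_norm)
      also have "\<dots> = (norm (c n) * r ^ n) * measure lebesgue (ball (0::complex) r)"
        by simp
      finally show "norm (\<integral>z. norm (u n z) \<partial>lebesgue) \<le> (norm (c n) * r ^ n) * measure lebesgue (ball (0::complex) r)"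
        by simp
    qed
    show "summable (\<lambda>n. (norm (c n) * r ^ n) * measure lebesgue (ball (0::complex) r))"
      by (rule summable_mult2[OF summ])
  qed
  moreover have "AE z in lebesgue. summable (\<lambda>n. norm (u n z))"
  proof (rule AE_I2)
    fix z show "summable (\<lambda>n. norm (u n z))"
    proof (rule summable_comparison_test[OF exI[of _ 0]])
      show "\<forall>n\<ge>0. norm (norm (u n z)) \<le> (norm (c n) * r ^ n) * indicator (ball 0 r) z"
        using u_norm by simp
      show "summable (\<lambda>n. (norm (c n) * r ^ n) * indicator (ball 0 r) z)"
        by (rule summable_mult2[OF summ])
    qed
  qed
  ultimately have "(\<lambda>n. \<integral>z. u n z \<partial>lebesgue) sums (\<integral>z. (\<Sum>n. u n z) \<partial>lebesgue)"
    using u_int by (intro sums_integral)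
  moreover have "(\<lambda>z. \<Sum>n. u n z) = (\<lambda>z. indicator (ball 0 r) z *\<^sub>R f z)"
    using u_sums by (simp add: sums_iff)
  moreover have "(\<integral>z. u n z \<partial>lebesgue) = (if n = 0 then f 0 * of_real (measure lebesgue (ball (0::complex) r)) else 0)" for n
  proof -
    have "(\<integral>z. u n z \<partial>lebesgue) = c n * (LINT z:ball 0 r|lebesgue. z ^ n)"
      unfolding u_def set_lebesgue_integral_def by (simp flip: integral_mult_right_zero add: algebra_simps)
    moreover have "(LINT z:ball (0::complex) r|lebesgue. (1::complex)) = of_real (measure lebesgue (ball (0::complex) r))"
      unfolding set_lebesgue_integral_def
      by (subst integral_scaleR_left)
        (simp_all add: scaleR_conv_of_real integrable_real_indicator emeasure_bounded_finite[unfolded infinity_ennreal_def])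
    ultimately show ?thesis
      using integral_ball_power_eq_0[of n r] by (auto simp: c_def)
  qed
  ultimately show ?thesis
    using sums_If_finite[of "\<lambda>n. n = 0" "\<lambda>_. f 0 * of_real (measure lebesgue (ball (0::complex) r))"]
    by (simp add: set_lebesgue_integral_def sums_iff)
qed

text \<open>The mean value property is applied to the square of \<open>f\<close>, which is again
  holomorphic, after moving the centre to the origin. Then the modulus goes under the
  integral.\<close>

lemma holomorphic_mean_square_le:
  assumes f: "f holomorphic_on ball a R" and r: "0 < r" "r < R"
  shows "(cmod (f a))\<^sup>2 * (pi * r\<^sup>2) \<le> (LINT z:ball a r|lebesgue. (cmod (f z))\<^sup>2)"
proof -
  define g where "g z = (f (a + z))\<^sup>2" for z
  have "(+) a ` ball 0 R = ball a R" by simp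
  then have "(\<lambda>z. f (a + z)) holomorphic_on ball 0 R"
    using f by (intro holomorphic_on_compose_gen[of "(+) a" _ f, unfolded o_def]) (auto intro!: holomorphic_intros)
  then have g: "g holomorphic_on ball 0 R"
    unfolding g_def by (intro holomorphic_intros)
  have cont: "continuous_on (ball a R) f"
    using f by (rule holomorphic_on_imp_continuous_on)
  have int: "set_integrable lebesgue (ball a r) (\<lambda>z. (f z)\<^sup>2)"
    by (intro set_integrable_ball_continuous continuous_intros continuous_on_subset[OF cont]) (use r in auto)
  have "(LINT z:ball 0 r|lebesgue. g z) = (LINT z:ball 0 r|lebesgue. \<bar>(cmod 1)\<^sup>2 - (cmod 0)\<^sup>2\<bar> *\<^sub>R (f (a + z))\<^sup>2)"
    by (simp add: g_def)
  also have "\<dots> = (LINT z:(+) a ` ball 0 r|lebesgue. (f z)\<^sup>2)"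
    by (rule complex_change_of_variables(2)) (use int in \<open>auto intro!: derivative_eq_intros\<close>)
  finally have "g 0 * of_real (measure lebesgue (ball (0::complex) r)) = (LINT z:ball a r|lebesgue. (f z)\<^sup>2)"
    using holomorphic_integral_ball_0[OF g r] by simp
  moreover have "measure lebesgue (ball (0::complex) r) = pi * r\<^sup>2"
    using r by (simp add: content_ball unit_ball_vol_2)
  ultimately have "(cmod (f a))\<^sup>2 * (pi * r\<^sup>2) = norm (LINT z:ball a r|lebesgue. (f z)\<^sup>2)"
    using r by (simp add: g_def norm_mult norm_power flip: \<open>g 0 * _ = _\<close>)
  also have "\<dots> \<le> (LINT z:ball a r|lebesgue. (cmod (f z))\<^sup>2)"
    using set_integral_norm_bound[OF int] by (simp add: norm_power)
  finally show ?thesis .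
qed

text \<open>The integral of |f|^2 over balls shrinking to \<open>a\<close> tends to 0. Through the
  disc of radius |z - a|/2 about \<open>z\<close> it controls |(z - a) f(z)|^2, so (z - a) f(z)
  tends to 0, which is Riemann's criterion for a removable singularity.\<close>

lemma square_integrable_removable_singularity:
  fixes f :: "complex \<Rightarrow> complex"
  assumes R: "R > 0" and f: "f holomorphic_on ball a R - {a}"
    and int: "set_integrable lebesgue (ball a R) (\<lambda>z. (cmod (f z))\<^sup>2)"
  obtains g where "g holomorphic_on ball a R" "\<And>z. z \<in> ball a R - {a} \<Longrightarrow> g z = f z"
proof -
  define N where "N s = (LINT z:ball a s|lebesgue. (cmod (f z))\<^sup>2)" for s
  have "(\<lambda>n. N (R / Suc n)) \<longlonglongrightarrow> (\<integral>z. (0::real) \<partial>(lebesgue :: complex measure))"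
    unfolding N_def set_lebesgue_integral_def
  proof (rule integral_dominated_convergence)
    show "integrable lebesgue (\<lambda>z. indicator (ball a R) z *\<^sub>R (cmod (f z))\<^sup>2)"
      using int by (simp add: set_integrable_def)
    show "(\<lambda>z. indicator (ball a (R / Suc n)) z *\<^sub>R (cmod (f z))\<^sup>2) \<in> borel_measurable lebesgue" for n
      using set_integrable_subset[OF int, of "ball a (R / Suc n)"] R
      by (auto simp: set_integrable_def field_simps subset_ball intro!: borel_measurable_integrable)
    show "AE z in lebesgue. (\<lambda>n. indicator (ball a (R / Suc n)) z *\<^sub>R (cmod (f z))\<^sup>2) \<longlonglongrightarrow> 0"
    \<comment> \<open>The point \<open>a\<close> lies in every ball, and the value
      \<open>f a\<close> is arbitrary; but one point is a null set.\<close>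
    proof (rule AE_I')
      show "{a} \<in> null_sets lebesgue" by (simp add: null_sets_completionI)
      have "(\<lambda>n. indicator (ball a (R / Suc n)) z *\<^sub>R (cmod (f z))\<^sup>2) \<longlonglongrightarrow> 0" if "z \<noteq> a" for z
      proof (rule tendsto_eventually)
        have "(\<lambda>n. R / real (Suc n)) \<longlonglongrightarrow> 0" by real_asymp
        then have "\<forall>\<^sub>F n in sequentially. R / real (Suc n) < dist a z"
          using that by (intro order_tendstoD) auto
        then show "\<forall>\<^sub>F n in sequentially. indicator (ball a (R / Suc n)) z *\<^sub>R (cmod (f z))\<^sup>2 = 0"
          by eventually_elim auto
      qed
      then show "{z \<in> space lebesgue. \<not> (\<lambda>n. indicator (ball a (R / Suc n)) z *\<^sub>R (cmod (f z))\<^sup>2) \<longlonglongrightarrow> 0} \<subseteq> {a}"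
        by auto
    qed
    show "AE z in lebesgue. norm (indicator (ball a (R / Suc n)) z *\<^sub>R (cmod (f z))\<^sup>2)
          \<le> indicator (ball a R) z *\<^sub>R (cmod (f z))\<^sup>2" for n
    proof (rule AE_I2)
      fix z
      have "R / Suc n \<le> R" using R by (simp add: field_simps)
      then show "norm (indicator (ball a (R / Suc n)) z *\<^sub>R (cmod (f z))\<^sup>2)
          \<le> indicator (ball a R) z *\<^sub>R (cmod (f z))\<^sup>2"
        by (auto simp: indicator_def)
    qed
  qed simp
  then have N0: "(\<lambda>n. N (R / Suc n)) \<longlonglongrightarrow> 0" by simp
  have "((\<lambda>z. (z - a) * f z) \<longlongrightarrow> 0) (at a)"
  proof (rule LIM_I)
    fix \<epsilon> :: real assume \<epsilon>: "\<epsilon> > 0"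
    \<comment> \<open>The bound is chosen to match the disc area pi (d/2)^2 = pi d^2/4
      below.\<close>
    have "\<forall>\<^sub>F n in sequentially. N (R / Suc n) < \<epsilon>\<^sup>2 * pi / 4"
      using \<epsilon> by (intro order_tendstoD[OF N0]) auto
    then obtain n where n: "N (R / Suc n) < \<epsilon>\<^sup>2 * pi / 4"
      by (meson eventually_happens' sequentially_bot)
    define s where "s = R / Suc n"
    have s: "0 < s" "s \<le> R" using R by (simp_all add: s_def field_simps)
    have "norm ((z - a) * f z - 0) < \<epsilon>" if z: "z \<noteq> a" "norm (z - a) < s / 2" for z
    proof -
      define d where "d = norm (z - a)"
      have d: "d > 0" "d < s / 2" using z by (simp_all add: d_def)
      \<comment> \<open>The mean value estimate needs holomorphy on a larger disc than the one
        integrated over, hence the radii \<open>d\<close> and \<open>d / 2\<close>. The larger disc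
        just avoids \<open>a\<close>, and \<open>d < s / 2\<close> keeps both within distance
        \<open>s\<close> of \<open>a\<close>.\<close>
      have sub: "ball z d \<subseteq> ball a R - {a}"
      proof
        fix w assume w: "w \<in> ball z d"
        have "dist a w \<le> dist a z + dist z w" by (rule dist_triangle)
        with w d s show "w \<in> ball a R - {a}"
          by (auto simp: d_def dist_norm norm_minus_commute)
      qed
      have sub2: "ball z (d / 2) \<subseteq> ball a s"
      proof
        fix w assume w: "w \<in> ball z (d / 2)"
        have "dist a w \<le> dist a z + dist z w" by (rule dist_triangle)
        with w d s show "w \<in> ball a s"
          by (auto simp: d_def dist_norm norm_minus_commute)
      qed
      have int_s: "set_integrable lebesgue (ball a s) (\<lambda>z. (cmod (f z))\<^sup>2)"
        using set_integrable_subset[OF int] s by (simp add: subset_ball)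
      have "(cmod (f z))\<^sup>2 * (pi * (d / 2)\<^sup>2) \<le> (LINT z:ball z (d / 2)|lebesgue. (cmod (f z))\<^sup>2)"
        using holomorphic_on_subset[OF f sub] d by (intro holomorphic_mean_square_le) auto
      also have "\<dots> \<le> N s"
        unfolding N_def set_lebesgue_integral_def
        using int_s set_integrable_subset[OF int_s _ sub2] sub2
        by (intro integral_mono) (auto simp: set_integrable_def indicator_def)
      also have "\<dots> < \<epsilon>\<^sup>2 * pi / 4" using n by (simp add: s_def)
      finally have "(d * cmod (f z))\<^sup>2 < \<epsilon>\<^sup>2"
        by (simp add: power_mult_distrib power_divide field_simps)
      then show ?thesis
        using \<epsilon> by (simp add: norm_mult d_def power2_less_imp_less)
    qed
    then show "\<exists>s>0. \<forall>z. z \<noteq> a \<and> norm (z - a) < s \<longrightarrow> norm ((z - a) * f z - 0) < \<epsilon>"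
      using s by (intro exI[of _ "s / 2"]) auto
  qed
  then have "\<exists>g. g holomorphic_on ball a R \<and> (\<forall>z \<in> ball a R - {a}. g z = f z)"
    using holomorphic_on_extend_lim[OF f] R by simp
  then show ?thesis using that by blast
qed

section \<open>Reflection in the unit circle\<close>

text \<open>Schwarz reflection where the symmetry is given not on the circle but on the real axis,
  which crosses it at 1 and -1. Each half circle needs its own base point, since the excluded points
  separate them.\<close>

lemma circle_reflection_extension:
  assumes V: "open V" "cball 0 1 - {\<i>, -\<i>} \<subseteq> V" and h: "h holomorphic_on V"
    and sym: "\<And>s. s = 1 \<or> s = -1 \<Longrightarrow> \<forall>\<^sub>F t in at s. h (of_real (inverse t)) = cnj (h (of_real t))"
  obtains H where "H holomorphic_on - {\<i>, -\<i>}"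
    "\<And>z. z \<in> cball 0 1 \<Longrightarrow> H z = h z" "\<And>z. 1 < cmod z \<Longrightarrow> H z = cnj (h (inverse (cnj z)))"
proof -
  \<comment> \<open>Conjugating both before and after a holomorphic function gives a holomorphic
    function.\<close>
  define h' where "h' = cnj \<circ> (\<lambda>z. h (inverse z)) \<circ> cnj"
  \<comment> \<open>The origin is excluded explicitly, since \<open>inverse 0 = 0\<close> lies in
    \<open>V\<close>.\<close>
  define W where "W = {z. z \<noteq> 0 \<and> inverse (cnj z) \<in> V}"
  have openW: "open W"
  proof -
    have "open ((- {0}) \<inter> (\<lambda>z. inverse (cnj z)) -` V)"
      by (intro continuous_open_preimage V(1)) (auto intro!: continuous_intros)
    moreover have "W = (- {0}) \<inter> (\<lambda>z. inverse (cnj z)) -` V" by (auto simp: W_def)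
    ultimately show ?thesis by simp
  qed
  have h': "h' holomorphic_on W"
    unfolding h'_def
  proof (rule holomorphic_on_compose_cnj_cnj[OF _ openW])
    show "(\<lambda>z. h (inverse z)) holomorphic_on cnj ` W"
      by (rule holomorphic_on_compose_gen[OF _ h, unfolded o_def])
        (auto simp: W_def intro!: holomorphic_intros)
  qed
  have outer: "z \<in> W" if "1 < cmod z" for z
  proof -
    have "cmod (inverse (cnj z)) < 1" using that by (simp add: norm_inverse inverse_less_1_iff)
    then have "inverse (cnj z) \<in> cball 0 1 - {\<i>, -\<i>}" by auto
    then show ?thesis using V that by (auto simp: W_def)
  qed
  have circle: "inverse (cnj z) = z" if "cmod z = 1" for z
    using that complex_norm_square[of z] by (simp add: field_simps inverse_eq_divide)
       (metis nonzero_eq_divide_eq complex_cnj_zero_iff norm_zero zero_neq_one)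
  define H where "H z = (if cmod z \<le> 1 then h z else h' z)" for z
  have arc: "\<exists>S. open S \<and> {z. cmod z = 1 \<and> s * Re z > 0} \<subseteq> S \<and> H holomorphic_on S"
    if s: "s = 1 \<or> s = -1" for s :: real
  proof -
    define A where "A = {z. cmod z = 1 \<and> s * Re z > 0}"
    define S where "S = connected_component_set (V \<inter> W) (of_real s)"
    have AVW: "A \<subseteq> V \<inter> W"
    proof
      fix z assume z: "z \<in> A"
      then have "z \<in> cball 0 1 - {\<i>, -\<i>}" by (auto simp: A_def)
      with V have "z \<in> V" by blast
      moreover have "z \<noteq> 0" using z by (auto simp: A_def)
      ultimately show "z \<in> V \<inter> W" using circle[of z] z by (auto simp: W_def A_def)
    qed
    \<comment> \<open>The parametrisation shows that the arc is connected; the factor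
      \<open>s\<close> covers the right and the left half circle alike.\<close>
    have "A = (\<lambda>t. of_real s * cis t) ` {- (pi / 2)<..<pi / 2}"
    proof (intro equalityI subsetI)
      fix z assume z: "z \<in> A"
      define w where "w = of_real s * z"
      have w: "cmod w = 1" "Re w > 0" using z s by (auto simp: A_def w_def norm_mult)
      then have "w = cis (Arg w)"
        using Complex.cis_Arg[of w] by (cases "w = 0") (auto simp: sgn_div_norm)
      moreover have "\<bar>Arg w\<bar> < pi / 2" using w Re_Ln_pos_lt[of w] by (cases "w = 0") (auto simp: Arg_eq_Im_Ln)
      moreover have "z = of_real s * w" using s by (auto simp: w_def)
      ultimately show "z \<in> (\<lambda>t. of_real s * cis t) ` {- (pi / 2)<..<pi / 2}"
        by (intro image_eqI[of _ _ "Arg w"]) auto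
    next
      fix z assume "z \<in> (\<lambda>t. of_real s * cis t) ` {- (pi / 2)<..<pi / 2}"
      then show "z \<in> A" using s cos_gt_zero_pi by (auto simp: A_def norm_mult)
    qed
    then have "connected A"
      by (simp add: connected_continuous_image continuous_intros)
    moreover have sA: "of_real s \<in> A" using s by (auto simp: A_def)
    ultimately have AS: "A \<subseteq> S" unfolding S_def by (intro connected_component_maximal AVW)
    have S: "open S" "connected S" "S \<subseteq> V \<inter> W"
      unfolding S_def using connected_component_subset[of "V \<inter> W"]
      by (auto intro!: open_connected_component V openW)
    obtain d where d: "d > 0" "\<And>t. t \<noteq> s \<Longrightarrow> dist t s < d \<Longrightarrow> h (of_real (inverse t)) = cnj (h (of_real t))"
      using sym[OF s] unfolding eventually_at by auto
    define T where "T = {z \<in> S. h' z - h z = 0}"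
    \<comment> \<open>At real points near \<open>s\<close> the symmetry says that \<open>h'\<close>
      and \<open>h\<close> agree, so zeros of the difference accumulate at \<open>s\<close>.\<close>
    have lim: "of_real s islimpt T"
      unfolding islimpt_approachable
    proof (intro allI impI)
      fix e :: real assume e: "e > 0"
      obtain e' where e': "e' > 0" "ball (of_real s) e' \<subseteq> S"
        using S(1) AS sA by (meson open_contains_ball subsetD)
      define t where "t = s + min (min d e) e' / 2"
      have t: "t \<noteq> s" "dist t s < d" "dist t s < e" "dist t s < e'"
        using d e e' by (auto simp: t_def dist_real_def)
      have "dist (complex_of_real s) (of_real t) < e'" using t by (simp add: dist_commute)
      then have "complex_of_real t \<in> T"
        unfolding T_def using e' d(2)[OF t(1,2)] by (auto simp: h'_def)
      then show "\<exists>x'\<in>T. x' \<noteq> complex_of_real s \<and> dist x' (complex_of_real s) < e"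
        using t by (intro bexI[of _ "of_real t"]) auto
    qed
    \<comment> \<open>\<open>S\<close> is a connected neighbourhood of the whole open half circle, so the symmetry
      near the real point \<open>s\<close> propagates along the circle up to \<open>\<plusminus>\<i>\<close>.\<close>
    have eq: "h' z = h z" if "z \<in> S" for z
    proof -
      have "h' z - h z = 0"
        using analytic_continuation[of "\<lambda>z. h' z - h z" S T "of_real s" z] S AS sA that lim
          holomorphic_on_subset[OF h, of S] holomorphic_on_subset[OF h', of S]
        by (auto simp: T_def intro!: holomorphic_intros)
      then show ?thesis by simp
    qed
    \<comment> \<open>On \<open>S\<close> the two branches of \<open>H\<close> coincide, so its case
      distinction is invisible there.\<close>
    have "H holomorphic_on S \<longleftrightarrow> h holomorphic_on S"
      by (rule holomorphic_cong) (auto simp: H_def eq)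
    with holomorphic_on_subset[OF h, of S] S AS show ?thesis unfolding A_def by auto
  qed
  obtain S1 where S1: "open S1" "{z. cmod z = 1 \<and> 1 * Re z > 0} \<subseteq> S1" "H holomorphic_on S1"
    using arc[of 1] by blast
  obtain S2 where S2: "open S2" "{z. cmod z = 1 \<and> (-1) * Re z > 0} \<subseteq> S2" "H holomorphic_on S2"
    using arc[of "-1"] by blast
  have inn: "H holomorphic_on ball 0 1"
  proof -
    have "H holomorphic_on ball 0 1 \<longleftrightarrow> h holomorphic_on ball 0 1"
      by (rule holomorphic_cong) (auto simp: H_def)
    moreover have "ball 0 1 \<subseteq> V" using V(2) by force
    ultimately show ?thesis using holomorphic_on_subset[OF h] by simp
  qed
  have out: "H holomorphic_on - cball 0 1"
  proof -
    have "H holomorphic_on - cball 0 1 \<longleftrightarrow> h' holomorphic_on - cball 0 1"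
      by (rule holomorphic_cong) (auto simp: H_def)
    moreover have "- cball 0 1 \<subseteq> W" using outer by auto
    ultimately show ?thesis using holomorphic_on_subset[OF h'] by simp
  qed
  have "H holomorphic_on (ball 0 1 \<union> - cball 0 1) \<union> (S1 \<union> S2)"
    using S1 S2 inn out by (intro holomorphic_on_Un open_Un) (auto intro: open_Compl)
  moreover have "- {\<i>, -\<i>} \<subseteq> (ball 0 1 \<union> - cball 0 1) \<union> (S1 \<union> S2)"
  proof
    fix z assume z: "z \<in> - {\<i>, -\<i>}"
    have "Re z \<noteq> 0" if "cmod z = 1"
    proof
      assume "Re z = 0"
      with that have "\<bar>Im z\<bar> = 1" by (simp add: cmod_def)
      with \<open>Re z = 0\<close> z show False by (auto simp: complex_eq_iff abs_if split: if_splits)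
    qed
    then show "z \<in> (ball 0 1 \<union> - cball 0 1) \<union> (S1 \<union> S2)"
      using S1(2) S2(2) by (force simp: not_less not_le)
  qed
  ultimately have "H holomorphic_on - {\<i>, -\<i>}" by (rule holomorphic_on_subset)
  then show ?thesis by (rule that) (auto simp: H_def h'_def)
qed

section \<open>Square integrability across the circle and Liouville's theorem\<close>

text \<open>Inversion has Jacobian |z|^(-4), which exceeds 1/16 on this annulus and can be divided
  out. The outer radius 2 leaves room for the unit balls about \<open>\<i>\<close> and
  \<open>-\<i>\<close>.\<close>

lemma set_integrable_circle_inversion:
  fixes k :: "complex \<Rightarrow> real"
  assumes k: "set_integrable lebesgue (ball 0 1) k"
  shows "set_integrable lebesgue {z. 1 < cmod z \<and> cmod z < 2} (\<lambda>z. k (inverse (cnj z)))"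
proof -
  define A where "A = {z::complex. 1 < cmod z \<and> cmod z < 2}"
  define \<sigma> :: "complex \<Rightarrow> complex" where "\<sigma> z = inverse (cnj z)" for z
  \<comment> \<open>Inversion is antiholomorphic: only the Wirtinger derivative in the conjugate
    variable is nonzero.\<close>
  define b where "b z = - 1 / (cnj z)\<^sup>2" for z :: complex
  have openA: "open A" unfolding A_def
    by (intro open_Collect_conj open_Collect_less continuous_intros)
  have A0: "z \<noteq> 0" if "z \<in> A" for z using that by (auto simp: A_def)
  have sub: "\<sigma> ` A \<subseteq> ball 0 1"
    by (auto simp: A_def \<sigma>_def norm_inverse inverse_less_1_iff)
  have imA: "\<sigma> ` A \<in> sets lebesgue"
  proof -
    \<comment> \<open>\<open>\<sigma>\<close> is its own inverse, so the image is a preimage and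
      therefore open.\<close>
    have "\<sigma> ` A = (- {0}) \<inter> \<sigma> -` A"
    proof (intro equalityI subsetI)
      fix w assume "w \<in> (- {0}) \<inter> \<sigma> -` A"
      then show "w \<in> \<sigma> ` A" by (intro image_eqI[of _ _ "\<sigma> w"]) (auto simp: \<sigma>_def)
    qed (use A0 in \<open>auto simp: \<sigma>_def\<close>)
    moreover have "open ((- {0}) \<inter> \<sigma> -` A)"
      unfolding \<sigma>_def by (intro continuous_open_preimage openA) (auto intro!: continuous_intros)
    ultimately show ?thesis by simp
  qed
  have "set_integrable lebesgue (\<sigma> ` A) k"
    by (rule set_integrable_subset[OF k imA sub])
  \<comment> \<open>The change of variables is stated for complex integrands, so \<open>k\<close> is
    embedded here and real parts are taken afterwards.\<close>
  then have int: "set_integrable lebesgue (\<sigma> ` A) (\<lambda>z. of_real (k z) :: complex)"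
    unfolding set_integrable_def by (simp flip: of_real_mult add: scaleR_conv_of_real)
  have "set_integrable lebesgue A (\<lambda>z. \<bar>(cmod 0)\<^sup>2 - (cmod (b z))\<^sup>2\<bar> *\<^sub>R (of_real (k (\<sigma> z)) :: complex))"
  proof (rule complex_change_of_variables(1)[OF _ _ _ int])
    show "A \<in> sets lebesgue" using openA by simp
    show "inj_on \<sigma> A" by (auto simp: inj_on_def \<sigma>_def)
    show "(\<sigma> has_derivative (\<lambda>h. 0 * h + b z * cnj h)) (at z within A)" if "z \<in> A" for z
      unfolding \<sigma>_def b_def using A0[OF that]
      by (auto intro!: derivative_eq_intros simp: power2_eq_square field_simps)
  qed
  then have "set_integrable lebesgue A (\<lambda>z. (1 / cmod z ^ 4) * k (\<sigma> z))" (is "set_integrable _ _ ?D")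
    unfolding set_integrable_def
    by (auto dest!: integrable_Re simp: b_def norm_divide norm_power power_divide)
  define D where "D z = indicator A z * ((1 / cmod z ^ 4) * k (\<sigma> z))" for z
  have D: "integrable lebesgue D"
    using \<open>set_integrable lebesgue A ?D\<close> by (simp add: set_integrable_def D_def[abs_def])
  \<comment> \<open>Multiplying by |z|^4, at most 16 on \<open>A\<close>, cancels the
    Jacobian.\<close>
  have "integrable lebesgue (\<lambda>z. cmod z ^ 4 * D z)"
  proof (rule Bochner_Integration.integrable_bound)
    show "integrable lebesgue (\<lambda>z. 16 * D z)"
      using D by (rule integrable_mult_right)
    have "(\<lambda>z::complex. cmod z ^ 4) \<in> borel_measurable lebesgue"
      by (intro measurable_completion) simp
    then show "(\<lambda>z. cmod z ^ 4 * D z) \<in> borel_measurable lebesgue"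
      using borel_measurable_integrable[OF D] by (rule borel_measurable_times)
    show "AE z in lebesgue. norm (cmod z ^ 4 * D z) \<le> norm (16 * D z)"
    proof (rule AE_I2)
      fix z
      have "cmod z ^ 4 \<le> 2 ^ 4" if "z \<in> A" using that by (intro power_mono) (auto simp: A_def)
      then have "cmod z ^ 4 * \<bar>D z\<bar> \<le> 16 * \<bar>D z\<bar>"
        by (cases "z \<in> A") (simp add: mult_right_mono, simp add: D_def)
      then show "norm (cmod z ^ 4 * D z) \<le> norm (16 * D z)"
        by (simp add: abs_mult)
    qed
  qed
  moreover have "(\<lambda>z. cmod z ^ 4 * D z) = (\<lambda>z. indicator A z *\<^sub>R k (\<sigma> z))"
    by (rule ext) (use A0 in \<open>auto simp: indicator_def D_def\<close>)
  ultimately show ?thesis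
    by (simp add: set_integrable_def A_def \<sigma>_def)
qed

text \<open>Square integrability on both sides of the circle makes the singularities of the
  continuation removable. Inversion sends infinity to 0, where \<open>h\<close> is continuous, so
  the entire extension tends to \<open>cnj (h 0)\<close> at infinity and equals it
  everywhere.\<close>

lemma circle_reflection_constant:
  assumes V: "open V" "cball 0 1 - {\<i>, -\<i>} \<subseteq> V" and h: "h holomorphic_on V"
    and sym: "\<And>s. s = 1 \<or> s = -1 \<Longrightarrow> \<forall>\<^sub>F t in at s. h (of_real (inverse t)) = cnj (h (of_real t))"
    and int: "set_integrable lebesgue (ball 0 1) (\<lambda>z. (cmod (h z))\<^sup>2)"
  obtains c where "\<And>z. z \<in> cball 0 1 - {\<i>, -\<i>} \<Longrightarrow> h z = c"
proof -
  obtain H where H: "H holomorphic_on - {\<i>, -\<i>}"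
    "\<And>z. z \<in> cball 0 1 \<Longrightarrow> H z = h z" "\<And>z. 1 < cmod z \<Longrightarrow> H z = cnj (h (inverse (cnj z)))"
    using circle_reflection_extension[OF V h sym] by blast
  define A where "A = {z::complex. 1 < cmod z \<and> cmod z < 2}"
  let ?k = "\<lambda>z. (cmod (H z))\<^sup>2"
  have "set_integrable lebesgue A ?k \<longleftrightarrow> set_integrable lebesgue A (\<lambda>z. (cmod (h (inverse (cnj z))))\<^sup>2)"
    by (intro set_integrable_cong) (auto simp: A_def H)
  then have intA: "set_integrable lebesgue A ?k"
    using set_integrable_circle_inversion[OF int] by (simp add: A_def)
  have "set_integrable lebesgue (ball 0 1) ?k \<longleftrightarrow> set_integrable lebesgue (ball 0 1) (\<lambda>z. (cmod (h z))\<^sup>2)"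
    by (intro set_integrable_cong) (auto simp: H)
  with int have int1: "set_integrable lebesgue (ball 0 1) ?k" by simp
  have openA: "open A" unfolding A_def
    by (intro open_Collect_conj open_Collect_less continuous_intros)
  have "set_integrable lebesgue (ball 0 1 \<union> A) ?k"
    using openA by (intro set_integrable_Un int1 intA) auto
  \<comment> \<open>Within \<open>ball 0 2\<close>, the disc and the annulus miss only the unit
    circle, a null set.\<close>
  moreover have "?k absolutely_integrable_on (ball 0 1 \<union> A) \<longleftrightarrow> ?k absolutely_integrable_on (ball 0 2)"
  proof (rule absolutely_integrable_spike_set_eq)
    have 1: "{z \<in> (ball 0 1 \<union> A) - ball 0 2. ?k z \<noteq> 0} = {}" by (auto simp: A_def)
    show "negligible {z \<in> (ball 0 1 \<union> A) - ball 0 2. ?k z \<noteq> 0}" unfolding 1 by simp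
    show "negligible {z \<in> ball 0 2 - (ball 0 1 \<union> A). ?k z \<noteq> 0}"
      by (rule negligible_subset[OF negligible_sphere[of 0 1]]) (auto simp: A_def)
  qed
  ultimately have int2: "set_integrable lebesgue (ball 0 2) ?k" by simp
  \<comment> \<open>Radius 1 keeps the ball inside \<open>ball 0 2\<close> and away from the
    opposite singularity.\<close>
  have ex: "\<exists>g. g holomorphic_on ball a 1 \<and> (\<forall>z\<in>ball a 1 - {a}. g z = H z)" if a: "a = \<i> \<or> a = - \<i>" for a
  proof -
    have sub: "ball a 1 - {a} \<subseteq> - {\<i>, -\<i>}"
      using a by (auto simp: dist_norm)
    have "ball a 1 \<subseteq> ball 0 2"
    proof
      fix z assume "z \<in> ball a 1"
      then show "z \<in> ball 0 2" using a norm_triangle_ineq4[of a "a - z"] by (auto simp: dist_norm)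
    qed
    then have "set_integrable lebesgue (ball a 1) ?k"
      by (intro set_integrable_subset[OF int2]) auto
    then show ?thesis
      using square_integrable_removable_singularity[OF _ holomorphic_on_subset[OF H(1) sub]]
      by (metis zero_less_one)
  qed
  obtain g1 where g1: "g1 holomorphic_on ball \<i> 1" "\<And>z. z\<in>ball \<i> 1 - {\<i>} \<Longrightarrow> g1 z = H z"
    using ex[of \<i>] by blast
  obtain g2 where g2: "g2 holomorphic_on ball (-\<i>) 1" "\<And>z. z\<in>ball (-\<i>) 1 - {-\<i>} \<Longrightarrow> g2 z = H z"
    using ex[of "-\<i>"] by blast
  \<comment> \<open>Only the values at the two singular points change; elsewhere the local
    extensions agree with \<open>H\<close>.\<close>
  define E where "E z = (if z = \<i> then g1 z else if z = -\<i> then g2 z else H z)" for z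
  have i: "\<i> \<notin> ball (-\<i>) 1" "-\<i> \<notin> ball \<i> 1" by (auto simp: dist_norm)
  have "E holomorphic_on - {\<i>, -\<i>} \<longleftrightarrow> H holomorphic_on - {\<i>, -\<i>}"
    by (rule holomorphic_cong) (auto simp: E_def)
  moreover have "E holomorphic_on ball \<i> 1 \<longleftrightarrow> g1 holomorphic_on ball \<i> 1"
    using i g1(2) by (intro holomorphic_cong) (auto simp: E_def)
  moreover have "E holomorphic_on ball (-\<i>) 1 \<longleftrightarrow> g2 holomorphic_on ball (-\<i>) 1"
    using i g2(2) by (intro holomorphic_cong) (auto simp: E_def)
  ultimately have "E holomorphic_on (- {\<i>, -\<i>}) \<union> (ball \<i> 1 \<union> ball (-\<i>) 1)"
    using H(1) g1(1) g2(1) by (intro holomorphic_on_Un) (auto intro!: open_Compl finite_imp_closed)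
  moreover have "(- {\<i>, -\<i>}) \<union> (ball \<i> 1 \<union> ball (-\<i>) 1) = UNIV" by auto
  ultimately have E: "E holomorphic_on UNIV" by simp
  have "(E \<longlongrightarrow> cnj (h 0)) at_infinity"
  proof (rule Lim_transform_eventually)
    have "ball 0 1 \<subseteq> V" using V(2) by force
    then have "0 \<in> V" by auto
    then have "isCont h 0"
      using V(1) holomorphic_on_imp_continuous_on[OF h] by (simp add: continuous_on_eq_continuous_at)
    moreover have "((\<lambda>z. inverse (cnj z)) \<longlongrightarrow> 0) at_infinity"
      by (rule filterlim_compose[OF tendsto_inverse_0]) (simp add: filterlim_at_infinity_conv_norm_at_top filterlim_norm_at_top)
    ultimately show "((\<lambda>z. cnj (h (inverse (cnj z)))) \<longlongrightarrow> cnj (h 0)) at_infinity"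
      by (intro tendsto_cnj isCont_tendsto_compose[of _ h])
    have "\<forall>\<^sub>F z::complex in at_infinity. 2 \<le> cmod z"
      by (auto simp: eventually_at_infinity)
    then show "\<forall>\<^sub>F z in at_infinity. cnj (h (inverse (cnj z))) = E z"
      by eventually_elim (auto simp: E_def H(3))
  qed
  from Liouville_weak[OF E this] have "E z = cnj (h 0)" for z .
  then show ?thesis using H(2) that[of "cnj (h 0)"] by (metis DiffE E_def insertCI)
qed

section \<open>Dilation correlations\<close>

text \<open>The substitution contributes the power of |t| and turns the integrand into cnj(f(t x))
  f(x), the conjugate of the integrand for \<open>t\<close>.\<close>

lemma dilation_corr_inverse:
  fixes f :: "'a::euclidean_space \<Rightarrow> complex"
  assumes f: "L2_fun f" and t: "t \<noteq> 0"
  shows "dilation_corr f (inverse t) = of_real (\<bar>t\<bar> ^ DIM('a)) * cnj (dilation_corr f t)"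
proof -
  have [measurable]: "f \<in> borel_measurable lebesgue" using f by (simp add: L2_fun_def)
  \<comment> \<open>Writing Lebesgue measure as a multiple of its push-forward under scaling splits
    the substitution into \<open>integral_density\<close> and \<open>integral_distr\<close>.\<close>
  have leb: "(lebesgue :: 'a measure) = density (distr lebesgue lebesgue (\<lambda>x. t *\<^sub>R x)) (\<lambda>_. ennreal (\<bar>t\<bar> ^ DIM('a)))"
    using lebesgue_affine_euclidean[of "\<lambda>_. t" "0::'a"] t
    unfolding scaleR_scaleR[symmetric] scaleR_sum_right[symmetric] euclidean_representation
    by simp
  have m: "(\<lambda>x. f (s *\<^sub>R x)) \<in> borel_measurable lebesgue" for s
    by (rule measurable_compose[OF lebesgue_measurable_scaling]) measurable
  have M: "(\<lambda>x. cnj (f x) * f (inverse t *\<^sub>R x)) \<in> borel_measurable lebesgue"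
    by (intro borel_measurable_times m measurable_compose[OF \<open>f \<in> _\<close>]
        borel_measurable_continuous_onI continuous_intros)
  have "dilation_corr f (inverse t) = (\<integral>x. cnj (f x) * f (inverse t *\<^sub>R x)
      \<partial>density (distr lebesgue lebesgue (\<lambda>x. t *\<^sub>R x)) (\<lambda>_. ennreal (\<bar>t\<bar> ^ DIM('a))))"
    unfolding dilation_corr_def by (subst leb) (rule refl)
  also have "\<dots> = (\<integral>x. (\<bar>t\<bar> ^ DIM('a)) *\<^sub>R (cnj (f x) * f (inverse t *\<^sub>R x)) \<partial>distr lebesgue lebesgue (\<lambda>x. t *\<^sub>R x))"
    using M by (intro integral_density) auto
  also have "\<dots> = (\<integral>x. (\<bar>t\<bar> ^ DIM('a)) *\<^sub>R (cnj (f (t *\<^sub>R x)) * f (inverse t *\<^sub>R (t *\<^sub>R x))) \<partial>lebesgue)"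
    using M by (intro integral_distr lebesgue_measurable_scaling borel_measurable_scaleR) auto
  also have "\<dots> = of_real (\<bar>t\<bar> ^ DIM('a)) * (\<integral>x. cnj (cnj (f x) * f (t *\<^sub>R x)) \<partial>lebesgue)"
    using t by (simp add: scaleR_conv_of_real mult.commute)
  also have "(\<integral>x. cnj (cnj (f x) * f (t *\<^sub>R x)) \<partial>lebesgue) = cnj (dilation_corr f t)"
    unfolding dilation_corr_def by (rule Bochner_Integration.integral_cnj)
  finally show ?thesis .
qed

text \<open>This value yields both the sign of \<open>c0\<close> and the vanishing of
  \<open>f\<close> when \<open>c0 = 0\<close>.\<close>

lemma dilation_corr_1: "dilation_corr f 1 = of_real (\<integral>x. (cmod (f x))\<^sup>2 \<partial>lebesgue)"
proof -
  have "(\<lambda>x. cnj (f x) * f x) = (\<lambda>x. of_real ((cmod (f x))\<^sup>2))"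
    by (simp only: complex_norm_square mult.commute)
  then show ?thesis by (simp add: dilation_corr_def del: of_real_power)
qed

section \<open>The weight (1 + z^2)^(n/2) and its principal branch\<close>

text \<open>As |z^2| is at most 1, the sum can be a nonpositive real only if z^2 = -1. Hence the
  principal branch of the weight is holomorphic near the punctured closed disc.\<close>

lemma one_plus_square_notin_nonpos_Reals:
  assumes "z \<in> cball 0 1 - {\<i>, -\<i>}"
  shows "1 + z\<^sup>2 \<notin> \<real>\<^sub>\<le>\<^sub>0"
proof
  assume "1 + z\<^sup>2 \<in> \<real>\<^sub>\<le>\<^sub>0"
  then have re: "Re (z\<^sup>2) \<le> - 1" and im: "Im (z\<^sup>2) = 0" by (auto simp: complex_nonpos_Reals_iff)
  have "cmod (z\<^sup>2) \<le> 1" using assms by (simp add: norm_power power_le_one)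
  with re have "Re (z\<^sup>2) = - 1" using abs_Re_le_cmod[of "z\<^sup>2"] by linarith
  with im have "z\<^sup>2 = \<i>\<^sup>2" by (simp add: complex_eq_iff)
  then have "z = \<i> \<or> z = - \<i>" by (simp only: power2_eq_iff)
  with assms show False by auto
qed

text \<open>Under inversion the weight changes by exactly the factor that cancels |t|^n in the
  symmetry of the correlation.\<close>

lemma one_plus_square_powr_inverse:
  fixes t :: real
  assumes "t \<noteq> 0"
  shows "\<bar>t\<bar> ^ n * (1 + (inverse t)\<^sup>2) powr (n / 2) = (1 + t\<^sup>2) powr (n / 2)"
proof -
  have "\<bar>t\<bar> ^ n = (t\<^sup>2) powr (n / 2)"
    using assms powr_powr[of "\<bar>t\<bar>" 2 "n / 2"] by (simp add: powr_realpow)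
  moreover have "t\<^sup>2 * (1 + (inverse t)\<^sup>2) = 1 + t\<^sup>2"
    using assms by (simp add: field_simps)
  ultimately show ?thesis
    by (simp flip: powr_mult)
qed

section \<open>From the constancy of the weighted extension to the correlation formula\<close>

theorem theorem6p1:
  fixes f :: "real ^ 'n \<Rightarrow> complex"
    and U :: "complex set" and G :: "complex \<Rightarrow> complex"
  assumes "L2_fun f"
    and "holomorphic_extension_on U G (dilation_corr f)"
    and "(\<integral>\<^sup>+ z \<in> ball 0 1.
            ennreal ((cmod (G z))\<^sup>2 * cmod (z\<^sup>2 + 1) ^ CARD('n)) \<partial>lborel) < \<infinity>"
  shows "\<exists>c0::real. c0 \<ge> 0 \<and>
           (\<forall>t::real. t \<noteq> 0 \<longrightarrow>
              dilation_corr f t =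
                complex_of_real (c0 * (1 + t\<^sup>2) powr (- (real CARD('n) / 2)))) \<and>
           (c0 = 0 \<longrightarrow>
              (\<forall>t::real. t \<noteq> 0 \<longrightarrow> dilation_corr f t = 0) \<and>
              (\<forall>z \<in> cball 0 1 - {\<i>, -\<i>}. G z = 0) \<and>
              (AE x in lebesgue. f x = 0))"
proof -
  define n where "n = CARD('n)"
  let ?F = "dilation_corr f"
  have U: "open U" "cball 0 1 - {\<i>, -\<i>} \<subseteq> U" "G holomorphic_on U"
    and GF: "\<And>t. t \<noteq> 0 \<Longrightarrow> of_real t \<in> U \<Longrightarrow> G (of_real t) = ?F t"
    using assms(2) by (auto simp: holomorphic_extension_on_def)
  have F_inv: "?F (inverse t) = of_real (\<bar>t\<bar> ^ n) * cnj (?F t)" if "t \<noteq> 0" for t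
    using dilation_corr_inverse[OF assms(1) that] by (simp add: n_def)
  \<comment> \<open>\<open>U\<close> may meet the branch cut of the power, so it is cut down to
    where 1 + z^2 avoids it.\<close>
  define V where "V = U \<inter> {z. 1 + z\<^sup>2 \<notin> \<real>\<^sub>\<le>\<^sub>0}"
  define h where "h z = G z * (1 + z\<^sup>2) powr of_real (n / 2)" for z
  have V: "open V" "cball 0 1 - {\<i>, -\<i>} \<subseteq> V"
  proof -
    have "open ((\<lambda>z::complex. 1 + z\<^sup>2) -` (- \<real>\<^sub>\<le>\<^sub>0))"
      by (intro open_vimage continuous_intros open_Compl closed_nonpos_Reals_complex)
    then show "open V" using U(1) by (auto simp: V_def vimage_def)
    show "cball 0 1 - {\<i>, -\<i>} \<subseteq> V"
      using U(2) one_plus_square_notin_nonpos_Reals unfolding V_def by blast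
  qed
  have h: "h holomorphic_on V"
    unfolding h_def V_def using holomorphic_on_subset[OF U(3)]
    by (intro holomorphic_intros) auto
  \<comment> \<open>Here 1 + t^2 is positive, so the complex power is the real one.\<close>
  have h_real: "h (of_real t) = ?F t * of_real ((1 + t\<^sup>2) powr (n / 2))" if "t \<noteq> 0" "of_real t \<in> U" for t
  proof -
    have "(1 + (of_real t)\<^sup>2 :: complex) powr of_real (n / 2) = of_real ((1 + t\<^sup>2) powr (n / 2))"
      by (subst powr_of_real[symmetric]) auto
    then show ?thesis using GF[OF that] by (simp add: h_def)
  qed
  have sym: "\<forall>\<^sub>F t in at s. h (of_real (inverse t)) = cnj (h (of_real t))" if s: "s = 1 \<or> s = -1" for s :: real
  proof -
    have sU: "complex_of_real s \<in> U" using s U(2) by (auto simp: complex_eq_iff)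
    have "((\<lambda>t. complex_of_real t) \<longlongrightarrow> of_real s) (at s)"
      by (intro tendsto_intros)
    then have 1: "\<forall>\<^sub>F t in at s. complex_of_real t \<in> U"
      using U(1) sU by (rule topological_tendstoD)
    \<comment> \<open>The extension is also evaluated at 1/t, which tends to 1/s = s and so
      eventually lies in \<open>U\<close>.\<close>
    have "((\<lambda>t. complex_of_real (inverse t)) \<longlongrightarrow> of_real (inverse s)) (at s)"
      using s by (intro tendsto_intros) auto
    then have 2: "\<forall>\<^sub>F t in at s. complex_of_real (inverse t) \<in> U"
      using U(1) sU s by (intro topological_tendstoD) auto
    have 3: "\<forall>\<^sub>F t in at s. t \<noteq> 0"
      by (rule eventually_neq_at_within)
    from 1 2 3 show ?thesis
    proof eventually_elim
      case (elim t)
      have "h (of_real (inverse t)) = ?F (inverse t) * of_real ((1 + (inverse t)\<^sup>2) powr (n / 2))"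
        using elim by (intro h_real) auto
      also have "\<dots> = cnj (?F t) * of_real (\<bar>t\<bar> ^ n * (1 + (inverse t)\<^sup>2) powr (n / 2))"
        using elim by (simp only: F_inv[OF \<open>t \<noteq> 0\<close>] of_real_mult mult_ac)
      also have "\<dots> = cnj (h (of_real t))"
        using elim unfolding one_plus_square_powr_inverse[OF \<open>t \<noteq> 0\<close>]
        by (subst h_real) simp_all
      finally show ?case .
    qed
  qed
  have ball_V: "ball 0 1 \<subseteq> V" using V(2) by force
  \<comment> \<open>The exponent is real, so the modulus of the power is the power of the modulus;
    squaring turns n/2 into n.\<close>
  have h_norm: "(cmod (h z))\<^sup>2 = (cmod (G z))\<^sup>2 * cmod (z\<^sup>2 + 1) ^ n" if "z \<in> ball 0 1" for z
  proof -
    have "1 + z\<^sup>2 \<noteq> 0" using that ball_V unfolding V_def by force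
    then have "(cmod (1 + z\<^sup>2) powr (n / 2))\<^sup>2 = cmod (1 + z\<^sup>2) ^ n"
      by (simp add: powr_powr flip: powr_realpow)
    then show ?thesis
      by (simp add: h_def norm_mult norm_powr_real_powr' power_mult_distrib add.commute)
  qed
  \<comment> \<open>The hypothesis is a nonnegative integral over \<open>lborel\<close>. Continuity
    supplies measurability, and completion passes to \<open>lebesgue\<close>.\<close>
  have "set_integrable lebesgue (ball 0 1) (\<lambda>z. (cmod (h z))\<^sup>2)"
  proof -
    have cont: "continuous_on (ball 0 1) (\<lambda>z. (cmod (h z))\<^sup>2)"
      using holomorphic_on_imp_continuous_on[OF holomorphic_on_subset[OF h ball_V]]
      by (intro continuous_intros)
    have meas: "(\<lambda>z. indicator (ball 0 1) z *\<^sub>R (cmod (h z))\<^sup>2) \<in> borel_measurable lborel"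
      using borel_measurable_continuous_on_indicator[OF _ cont] by simp
    have "integrable lborel (\<lambda>z. indicator (ball 0 1) z *\<^sub>R (cmod (h z))\<^sup>2)"
    proof (rule integrableI_nonneg[OF meas])
      have "(\<integral>\<^sup>+ z. ennreal (indicator (ball 0 1) z *\<^sub>R (cmod (h z))\<^sup>2) \<partial>lborel)
        = (\<integral>\<^sup>+ z \<in> ball 0 1. ennreal ((cmod (G z))\<^sup>2 * cmod (z\<^sup>2 + 1) ^ CARD('n)) \<partial>lborel)"
        by (intro nn_integral_cong) (auto simp: h_norm n_def indicator_def)
      then show "(\<integral>\<^sup>+ z. ennreal (indicator (ball 0 1) z *\<^sub>R (cmod (h z))\<^sup>2) \<partial>lborel) < \<infinity>"
        using assms(3) by simp
    qed simp
    then show ?thesis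
      using meas unfolding set_integrable_def by (simp add: integrable_completion)
  qed
  then obtain c where c: "\<And>z. z \<in> cball 0 1 - {\<i>, -\<i>} \<Longrightarrow> h z = c"
    using circle_reflection_constant[OF V h sym] by blast
  define I where "I = (\<integral>x. (cmod (f x))\<^sup>2 \<partial>lebesgue)"
  \<comment> \<open>This is h(1): the correlation at 1 is \<open>I\<close>, and the weight there is
    2^(n/2).\<close>
  define c0 where "c0 = I * 2 powr (n / 2)"
  have "1 \<in> cball 0 1 - {\<i>, -\<i>}" by (auto simp: complex_eq_iff)
  then have "c = h (of_real 1)" "of_real 1 \<in> U" using c U(2) by auto
  then have c_eq: "c = of_real c0"
    by (simp add: h_real dilation_corr_1 c0_def I_def del: of_real_1)
  \<comment> \<open>For these \<open>t\<close> the point lies in the closed disc, where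
    \<open>G\<close> is known to represent the correlation.\<close>
  have F_in: "?F t = of_real (c0 * (1 + t\<^sup>2) powr (- (n / 2)))" if t: "t \<noteq> 0" "\<bar>t\<bar> \<le> 1" for t
  proof -
    have *: "of_real t \<in> cball 0 1 - {\<i>, -\<i>}" using t by (auto simp: complex_eq_iff)
    then have "of_real t \<in> U" using U(2) by blast
    then have "?F t * of_real ((1 + t\<^sup>2) powr (n / 2)) = of_real c0"
      using h_real[OF t(1)] c[OF *] c_eq by simp
    moreover have "(1 + t\<^sup>2) powr (n / 2) \<noteq> 0" by (simp add: add_nonneg_eq_0_iff)
    ultimately show ?thesis by (simp add: powr_minus field_simps flip: of_real_mult)
  qed
  have F_eq: "?F t = of_real (c0 * (1 + t\<^sup>2) powr (- (n / 2)))" if t: "t \<noteq> 0" for t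
  proof (cases "\<bar>t\<bar> \<le> 1")
    case False
    \<comment> \<open>Outside the disc the formula is carried over from 1/t by the inversion
      symmetry; the conjugate disappears because the value is real.\<close>
    define s where "s = inverse t"
    have s: "s \<noteq> 0" "\<bar>s\<bar> \<le> 1" "t = inverse s"
      using False t by (auto simp: s_def field_simps abs_inverse)
    have "?F t = of_real (\<bar>s\<bar> ^ n * (c0 * (1 + s\<^sup>2) powr (- (n / 2))))"
      using F_inv[OF s(1)] F_in[OF s(1,2)] s(3) by simp
    also have "\<bar>s\<bar> ^ n * (c0 * (1 + s\<^sup>2) powr (- (n / 2))) = c0 * (1 + t\<^sup>2) powr (- (n / 2))"
    proof -
      have "(1 + s\<^sup>2) powr (n / 2) \<noteq> 0" "(1 + t\<^sup>2) powr (n / 2) \<noteq> 0" by (simp_all add: add_nonneg_eq_0_iff)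
      then show ?thesis
        using one_plus_square_powr_inverse[OF s(1), of n] s(3) by (simp add: powr_minus field_simps)
    qed
    finally show ?thesis .
  qed (use F_in t in auto)
  have I: "I \<ge> 0" unfolding I_def by simp
  have zero: "(\<forall>t::real. t \<noteq> 0 \<longrightarrow> ?F t = 0) \<and> (\<forall>z \<in> cball 0 1 - {\<i>, -\<i>}. G z = 0) \<and>
              (AE x in lebesgue. f x = 0)" if "c0 = 0"
  proof (intro conjI ballI allI impI)
    show "?F t = 0" if "t \<noteq> 0" for t using F_eq[OF that] \<open>c0 = 0\<close> by simp
    \<comment> \<open>\<open>h\<close> vanishes, and the weight has no zero on the punctured
      disc.\<close>
    show "G z = 0" if z: "z \<in> cball 0 1 - {\<i>, -\<i>}" for z
      using c[OF z] one_plus_square_notin_nonpos_Reals[OF z] \<open>c0 = 0\<close> c_eq by (auto simp: h_def)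
    \<comment> \<open>The factor 2^(n/2) is positive, so the squared norm of \<open>f\<close> must
      vanish.\<close>
    have "I = 0" using \<open>c0 = 0\<close> by (simp add: c0_def)
    then have "AE x in lebesgue. (cmod (f x))\<^sup>2 = 0"
      using assms(1) unfolding I_def L2_fun_def
      by (subst (asm) integral_nonneg_eq_0_iff_AE) auto
    then show "AE x in lebesgue. f x = 0" by simp
  qed
  show ?thesis
  proof (intro exI conjI)
    show "c0 \<ge> 0" using I by (simp add: c0_def)
    show "\<forall>t. t \<noteq> 0 \<longrightarrow> ?F t = of_real (c0 * (1 + t\<^sup>2) powr (- (real CARD('n) / 2)))"
      using F_eq by (simp add: n_def)
  qed (use zero in auto)
qed

end
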